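(* Let $G$ be an abelian group with no elements of order $2$. Then $G\nrightarrow(1)^{\langle\cdot\rangle}_2$: there is a colouring $c:G\to\{0,1\}$ such that for no nontrivial cyclic subgroup $H\subseteq G$ is $c$ constant on $H\setminus\{0\}$. (Consequently, for no nontrivial subgroup $H\subseteq G$ is $c$ constant on $H\setminus\{0\}$.) *)

theory Defs
  imports "HOL-Algebra.Algebra" "HOL-Analysis.Abstract_Topology_2"
begin

end

theory Submission
  imports Defs
begin

text \<open>If inversion fixes \<open>x\<close>, then \<open>x\<close> squares to \<one>, so its
  order divides the prime 2; as \<open>x\<close> is not \<one>, the order is exactly 2.\<close>

lemma (in group) inv_neq_self:
  assumes "x \<in> carrier G" "x \<noteq> \<one>" "ord x \<noteq> 2"
  shows "inv x \<noteq> x"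
proof
  assume "inv x = x"
  then have "x [^] (2::nat) = \<one>"
    using assms(1) r_inv[of x] by (simp add: numeral_2_eq_2)
  then have "ord x dvd 2"
    using assms(1) pow_eq_id by blast
  moreover have "ord x \<noteq> 1"
    using assms(1,2) ord_eq_1 by blast
  ultimately show False
    using assms(3) two_is_prime_nat unfolding prime_nat_iff by blast
qed

text \<open>Without elements of order 2, the pairs \<open>{x, inv x}\<close> with \<open>x \<noteq> \<one>\<close> have two elements,
  so a colour can be given to exactly one chosen element of each pair.\<close>

lemma (in group) ex_colouring_separating_inverses:
  assumes "\<forall>x\<in>carrier G. ord x \<noteq> 2"
  shows "\<exists>c \<in> carrier G \<rightarrow> {0, 1 :: nat}. \<forall>x\<in>carrier G - {\<one>}. c (inv x) \<noteq> c x"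
proof -
  \<comment> \<open>\<open>SOME\<close> is applied to a predicate that depends only on the unordered
    pair, so \<open>x\<close> and \<open>inv x\<close> receive the same representative.\<close>
  define r where "r x = (SOME y. y \<in> {x, inv x})" for x
  define c where "c x = (if x = r x then 0 else 1 :: nat)" for x
  have "c (inv x) \<noteq> c x" if x: "x \<in> carrier G" "x \<noteq> \<one>" for x
  proof -
    have "{inv x, inv (inv x)} = {x, inv x}"
      using x by auto
    then have "r (inv x) = r x"
      by (simp only: r_def)
    moreover have "r x \<in> {x, inv x}"
      unfolding r_def by (rule someI) (rule insertI1)
    moreover have "inv x \<noteq> x"
      using x assms inv_neq_self by blast
    \<comment> \<open>The common representative equals exactly one of the two distinct elements
      \<open>x\<close> and \<open>inv x\<close>, and only that one gets colour 0.\<close>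
    ultimately show ?thesis
      unfolding c_def by auto
  qed
  moreover have "c \<in> carrier G \<rightarrow> {0, 1}"
    by (simp add: c_def)
  ultimately show ?thesis
    by blast
qed

theorem theorem5p3:
  fixes G :: "('a, 'b) monoid_scheme" (structure)
  assumes "comm_group G"
    and "\<forall>x\<in>carrier G. group.ord G x \<noteq> 2"
  shows "\<exists>c \<in> carrier G \<rightarrow> {0, 1 :: nat}.
           \<not> (\<exists>H. subgroup H G \<and> H \<noteq> {\<one>} \<and> cyclic_group (G\<lparr>carrier := H\<rparr>)
                 \<and> c constant_on (H - {\<one>}))
         \<and> \<not> (\<exists>H. subgroup H G \<and> H \<noteq> {\<one>} \<and> c constant_on (H - {\<one>}))"
proof -
  interpret comm_group G by fact
  obtain c where c: "c \<in> carrier G \<rightarrow> {0, 1 :: nat}"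
    and c_inv: "\<forall>x\<in>carrier G - {\<one>}. c (inv x) \<noteq> c x"
    using ex_colouring_separating_inverses[OF assms(2)] by blast
  \<comment> \<open>Any nontrivial subgroup contains a whole pair \<open>x\<close>,
    \<open>inv x\<close> away from \<one>, hence both colours. Cyclic subgroups are a special case,
    so both conjuncts follow.\<close>
  have "\<not> c constant_on (H - {\<one>})" if H: "subgroup H G" "H \<noteq> {\<one>}" for H
  proof -
    obtain x where x: "x \<in> H" "x \<noteq> \<one>"
      using H subgroup.one_closed[OF H(1)] by auto
    then have "x \<in> carrier G"
      using subgroup.mem_carrier[OF H(1)] by simp
    then have "c (inv x) \<noteq> c x" "inv x \<noteq> \<one>"
      using x(2) c_inv by auto
    moreover have "inv x \<in> H"
      using subgroup.m_inv_closed[OF H(1) x(1)] .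
    ultimately show ?thesis
      using x unfolding constant_on_def by (metis DiffI singletonD)
  qed
  with c show ?thesis
    by blast
qed

end
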